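(* For every positive integer $n$, with $i=\sqrt{-1}$, $$\sum_{\substack{1\le k\le n\\ 4\mid k}}\binom nkB_{n-k}(x)\big((-1)^{\frac k4}2^{\frac k2-1}-1\big)=\frac n8\Big\{2(x-1)^{n-1}-2x^{n-1}+(x+i)^{n-1}+(x-i)^{n-1}-(x-1+i)^{n-1}-(x-1-i)^{n-1}\Big\}.$$
   Context: The Bernoulli numbers $B_n$ are defined by $B_0=1$ and $\sum_{k=0}^{n-1}\binom nkB_k=0$ for $n\ge 2$; the Bernoulli polynomials are $B_n(x)=\sum_{k=0}^n\binom nkB_kx^{n-k}$ for $n\ge 0$. *)

theory Defs
  imports Complex_Main
begin

text \<open>
  The recurrence with upper index \<open>n + 2\<close>, solved for its last term
  \<open>((n + 2) choose (n + 1)) B(n + 1)\<close>.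
\<close>
fun bernoulli :: "nat \<Rightarrow> real" where
  "bernoulli 0 = 1"
| "bernoulli (Suc n) =
     - (\<Sum>k\<le>n. of_nat (Suc (Suc n) choose k) * bernoulli k) / of_nat (Suc (Suc n))"

lemma bernoulli_recurrence:
  assumes "n \<ge> 2"
  shows "(\<Sum>k=0..n-1. of_nat (n choose k) * bernoulli k) = 0"
proof -
  obtain m where n: "n = Suc (Suc m)"
    using assms by (metis add_2_eq_Suc le_Suc_ex)
  have "Suc (Suc m) choose Suc m = Suc (Suc m)"
    by (metis binomial_Suc_n)
  then show ?thesis
    by (simp add: n atLeast0AtMost del: binomial_Suc_Suc of_nat_Suc)
qed

definition bernpoly :: "nat \<Rightarrow> 'a::real_algebra_1 \<Rightarrow> 'a" where
  "bernpoly n x = (\<Sum>k=0..n. of_nat (n choose k) * of_real (bernoulli k) * x ^ (n - k))"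

end

theory Submission imports Defs begin

text \<open>
  For \<open>4 dvd k\<close> we have \<open>(-1) ^ (k div 4) * 2 ^ (k div 2) = (1 + \<i>) ^ k\<close>, so the weight is
  \<open>(1 + \<i>) ^ k / 2 - 1\<close>. By the translation formula
  \<open>B\<^sub>n(x + a) = \<Sum>k\<le>n. (n choose k) * B\<^sub>n\<^sub>-\<^sub>k(x) * a ^ k\<close>, averaging over the fourth roots of unity
  expresses the left-hand side through the values of \<open>B\<^sub>n\<close> at \<open>x\<close>, \<open>x \<plusminus> 1\<close>, \<open>x \<plusminus> \<i>\<close> and
  \<open>x \<plusminus> 1 \<plusminus> \<i>\<close>. These nine points pair up into unit steps, each evaluated by
  \<open>B\<^sub>n(y + 1) - B\<^sub>n(y) = n * y ^ (n - 1)\<close>.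
\<close>

text \<open>Expanding each \<open>(x + y) ^ (n - j)\<close> binomially gives a sum over the triangle
  \<open>j + k \<le> n\<close>. Summing over \<open>j\<close> first leaves
  \<open>bernpoly (n - k) x\<close> as the coefficient of \<open>y ^ k\<close>.\<close>

lemma bernpoly_add:
  fixes x y :: "'a::{real_algebra_1, comm_ring_1}"
  shows "bernpoly n (x + y) = (\<Sum>k\<le>n. of_nat (n choose k) * bernpoly (n - k) x * y ^ k)"
proof -
  define f where "f j k = of_nat (n choose k) * of_nat ((n - k) choose j) *
      of_real (bernoulli j) * x ^ (n - k - j) * y ^ k" for j k
  have f: "of_nat (n choose j) * of_real (bernoulli j) *
      (of_nat ((n - j) choose k) * y ^ k * x ^ (n - j - k)) = f j k"
    if "j \<le> n" "k \<le> n - j" for j k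
  proof -
    \<comment> \<open>Both sides are the trinomial coefficient n! / (j! k! (n-j-k)!).\<close>
    have "(n choose j) * ((n - j) choose k) = (n choose k) * ((n - k) choose j)"
      using binomial_fact_lemma[of j n] binomial_fact_lemma[of k "n - j"]
        binomial_fact_lemma[of k n] binomial_fact_lemma[of j "n - k"] that
      by (smt (verit) choose_mult_lemma add.commute le_add_diff_inverse add_le_imp_le_diff
          diff_diff_left le_add1 le_diff_conv2 binomial_symmetric choose_mult diff_add_inverse
          trans_le_add2 diff_le_self le_trans)
    then have choose: "(of_nat (n choose j) * of_nat ((n - j) choose k) :: 'a) =
        of_nat (n choose k) * of_nat ((n - k) choose j)"
      by (metis of_nat_mult)
    have "of_nat (n choose j) * of_real (bernoulli j) *
        (of_nat ((n - j) choose k) * y ^ k * x ^ (n - j - k)) =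
        (of_nat (n choose j) * of_nat ((n - j) choose k)) *
        of_real (bernoulli j) * x ^ (n - k - j) * y ^ k"
      by (simp only: diff_right_commute[of n j k] mult_ac)
    then show ?thesis
      unfolding choose f_def .
  qed
  have "bernpoly n (x + y) = (\<Sum>j\<le>n. \<Sum>k\<le>n - j. f j k)"
    unfolding bernpoly_def atLeast0AtMost
  proof (rule sum.cong)
    fix j assume "j \<in> {..n}"
    then show "of_nat (n choose j) * of_real (bernoulli j) * (x + y) ^ (n - j) = (\<Sum>k\<le>n - j. f j k)"
      by (subst add.commute, subst binomial_ring, subst sum_distrib_left, intro sum.cong)
        (auto simp: f simp del: diff_diff_left)
  qed simp
  also have "\<dots> = (\<Sum>j\<le>n. \<Sum>k | k \<in> {..n} \<and> j + k \<le> n. f j k)"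
    by (intro sum.cong) auto
  also have "\<dots> = (\<Sum>k\<le>n. \<Sum>j | j \<in> {..n} \<and> j + k \<le> n. f j k)"
    by (rule sum.swap_restrict) auto
  also have "\<dots> = (\<Sum>k\<le>n. \<Sum>j\<le>n - k. f j k)"
    by (intro sum.cong) auto
  also have "\<dots> = (\<Sum>k\<le>n. of_nat (n choose k) * bernpoly (n - k) x * y ^ k)"
    by (simp add: f_def bernpoly_def atLeast0AtMost sum_distrib_left sum_distrib_right mult_ac)
  finally show ?thesis .
qed

lemma bernpoly_0: "bernpoly n 0 = of_real (bernoulli n)"
proof -
  have "bernpoly n (0 :: 'a) = (\<Sum>k\<in>{n}. of_nat (n choose k) * of_real (bernoulli k) * 0 ^ (n - k))"
    unfolding bernpoly_def by (rule sum.mono_neutral_right) (auto simp: power_0_left)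
  then show ?thesis by simp
qed

text \<open>For \<open>n \<ge> 2\<close> the recurrence kills all but the last term of the sum. For
  \<open>n = 1\<close> the extra 1 is the term \<open>bernoulli 0\<close>.\<close>

lemma bernpoly_1: "bernpoly n 1 = of_real (bernoulli n + (if n = 1 then 1 else 0))"
proof -
  have "(\<Sum>k\<le>n. of_nat (n choose k) * bernoulli k) = bernoulli n + (if n = 1 then 1 else 0)"
  proof (cases "n \<ge> 2")
    case True
    then obtain m where "n = Suc m" "m \<ge> 1"
      by (cases n) auto
    then show ?thesis
      using bernoulli_recurrence[OF True] by (simp add: atLeast0AtMost)
  next
    case False
    then have "n = 0 \<or> n = 1" by auto
    then show ?thesis by auto
  qed
  moreover have "bernpoly n 1 = of_real (\<Sum>k\<le>n. of_nat (n choose k) * bernoulli k)"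
    by (simp add: bernpoly_def atLeast0AtMost)
  ultimately show ?thesis by simp
qed

text \<open>Translating by \<open>y\<close> from the base points 1 and 0 leaves the coefficients
  \<open>bernpoly (n - k) 1 - bernpoly (n - k) 0\<close>, nonzero only for
  \<open>n - k = 1\<close>.\<close>

lemma bernpoly_plus_1:
  fixes y :: "'a::{real_algebra_1, comm_ring_1}"
  shows "bernpoly n (y + 1) = bernpoly n y + of_nat n * y ^ (n - 1)"
proof -
  have "bernpoly n (y + 1) - bernpoly n y =
      (\<Sum>k\<le>n. of_nat (n choose k) * (bernpoly (n - k) 1 - bernpoly (n - k) 0) * y ^ k)"
    using bernpoly_add[of n 1 y] bernpoly_add[of n 0 y]
    by (simp add: add.commute sum_subtractf algebra_simps)
  also have "\<dots> = (\<Sum>k\<le>n. if n = Suc k then of_nat n * y ^ k else 0)"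
    by (intro sum.cong) (auto simp: bernpoly_0 bernpoly_1)
  also have "\<dots> = of_nat n * y ^ (n - 1)"
    by (cases n) auto
  finally show ?thesis by (simp add: algebra_simps)
qed

lemma fourth_roots_of_unity_filter:
  "1 + (- 1) ^ k + \<i> ^ k + (- \<i>) ^ k = (if 4 dvd k then 4 else 0)"
proof -
  define q r where "q = k div 4" and "r = k mod 4"
  have k: "k = 4 * q + r" and r: "r \<in> {0, 1, 2, 3}"
    by (auto simp: q_def r_def)
  have "4 dvd k \<longleftrightarrow> r = 0"
    by (auto simp: r_def)
  moreover have "(- 1 :: complex) ^ 4 = 1" "\<i> ^ 4 = 1" "(- \<i>) ^ 4 = 1"
    by (simp_all add: power4_eq_xxxx)
  ultimately show ?thesis
    using r by (auto simp: k power_add power_mult power2_eq_square power3_eq_cube)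
qed

text \<open>Adding the translation formulas for the shifts \<open>w * a\<close> with
  \<open>w ^ 4 = 1\<close> multiplies the term of index \<open>k\<close> by the sum of all
  \<open>w ^ k\<close>, which the root-of-unity filter evaluates.\<close>

lemma bernpoly_multisection_4:
  fixes x a :: complex
  shows "4 * (\<Sum>k | k \<le> n \<and> 4 dvd k. of_nat (n choose k) * bernpoly (n - k) x * a ^ k) =
    bernpoly n (x + a) + bernpoly n (x - a) + bernpoly n (x + \<i> * a) + bernpoly n (x - \<i> * a)"
proof -
  let ?t = "\<lambda>k. of_nat (n choose k) * bernpoly (n - k) x"
  have "bernpoly n (x + a) + bernpoly n (x + (- 1) * a) + bernpoly n (x + \<i> * a) +
      bernpoly n (x + (- \<i>) * a) =
      (\<Sum>k\<le>n. ?t k * a ^ k * (1 + (- 1) ^ k + \<i> ^ k + (- \<i>) ^ k))"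
    unfolding bernpoly_add power_mult_distrib sum.distrib[symmetric]
    by (intro sum.cong) (simp_all only: algebra_simps mult_1_left)
  also have "\<dots> = (\<Sum>k\<le>n. if 4 dvd k then 4 * (?t k * a ^ k) else 0)"
    unfolding fourth_roots_of_unity_filter by (intro sum.cong) auto
  also have "\<dots> = (\<Sum>k | k \<in> {..n} \<and> 4 dvd k. 4 * (?t k * a ^ k))"
    by (rule sum.inter_filter[symmetric]) simp
  finally show ?thesis
    by (simp add: sum_distrib_left)
qed

text \<open>This rests on \<open>(1 + \<i>) ^ 4 = - 4\<close>. At \<open>k = 0\<close> it would
  fail: truncated subtraction makes the left side 1, not 1/2.\<close>

lemma weight_eq:
  assumes "4 dvd k" "k > 0"
  shows "(- 1) ^ (k div 4) * 2 ^ (k div 2 - 1) = (1 + \<i>) ^ k / 2"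
proof -
  obtain q where k: "k = 4 * Suc q"
    using assms by (metis dvd_def gr0_conv_Suc mult_0_right not_gr_zero)
  have "(1 + \<i>) ^ 4 = - 4"
    by (simp add: power4_eq_xxxx algebra_simps)
  then have "(1 + \<i>) ^ k = (- 1) ^ Suc q * (2 ^ 2) ^ Suc q"
    unfolding k power_mult by (simp flip: power_mult_distrib)
  moreover have "k div 4 = Suc q" "k div 2 - 1 = Suc (2 * q)"
    by (auto simp: k)
  ultimately show ?thesis
    by (simp add: power_mult)
qed

theorem theorem2p5:
  fixes n :: nat and x :: complex
  assumes "n > 0"
  shows "(\<Sum>k | 1 \<le> k \<and> k \<le> n \<and> 4 dvd k.
            of_nat (n choose k) * bernpoly (n - k) x * ((-1) ^ (k div 4) * 2 ^ (k div 2 - 1) - 1))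
       = of_nat n / 8 *
           (2 * (x - 1) ^ (n - 1) - 2 * x ^ (n - 1)
            + (x + \<i>) ^ (n - 1) + (x - \<i>) ^ (n - 1)
            - (x - 1 + \<i>) ^ (n - 1) - (x - 1 - \<i>) ^ (n - 1))"
  (is "?lhs = _")
proof -
  let ?t = "\<lambda>k. of_nat (n choose k) * bernpoly (n - k) x" and ?B = "bernpoly n :: complex \<Rightarrow> complex"
  define S where "S a = (\<Sum>k | k \<le> n \<and> 4 dvd k. ?t k * a ^ k)" for a
  have split: "{k. k \<le> n \<and> 4 dvd k} = insert 0 {k. 1 \<le> k \<and> k \<le> n \<and> 4 dvd k}"
    by auto
  have "?lhs = (\<Sum>k | 1 \<le> k \<and> k \<le> n \<and> 4 dvd k. ?t k * ((1 + \<i>) ^ k / 2 - 1 ^ k))"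
    by (intro sum.cong) (auto simp: weight_eq[unfolded One_nat_def])
  \<comment> \<open>The added index \<open>k = 0\<close> contributes
    \<open>?B x * (1/2 - 1)\<close>, which the last summand compensates.\<close>
  also have "\<dots> = (\<Sum>k | k \<le> n \<and> 4 dvd k. ?t k * ((1 + \<i>) ^ k / 2 - 1 ^ k)) + ?B x / 2"
    unfolding split by (subst sum.insert) auto
  also have "\<dots> = S (1 + \<i>) / 2 - S 1 + ?B x / 2"
    by (simp add: S_def sum_divide_distrib sum_subtractf right_diff_distrib)
  finally have lhs: "8 * ?lhs = 4 * S (1 + \<i>) - 2 * (4 * S 1) + 4 * ?B x"
    by simp
  have S: "4 * S a = ?B (x + a) + ?B (x - a) + ?B (x + \<i> * a) + ?B (x - \<i> * a)" for a
    unfolding S_def by (rule bernpoly_multisection_4)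
  have shift: "?B (y + 1) = ?B y + of_nat n * y ^ (n - 1)" for y
    by (rule bernpoly_plus_1)
  \<comment> \<open>Multiplication by \<open>\<i>\<close> permutes the corners
    \<open>\<plusminus>1 \<plusminus> \<i>\<close> of a square. The two right-hand corners are
    written as \<open>y + 1\<close> so that \<open>shift\<close> applies.\<close>
  have eqs: "x + (1 + \<i>) = (x + \<i>) + 1" "x - (1 + \<i>) = x - 1 - \<i>"
      "x + \<i> * (1 + \<i>) = x - 1 + \<i>" "x - \<i> * (1 + \<i>) = (x - \<i>) + 1"
    by (simp_all add: algebra_simps)
  have cancel: "x - 1 + 1 = x" "x - 1 + \<i> + 1 = x + \<i>" "x - 1 - \<i> + 1 = x - \<i>"
    by simp_all
  have steps: "?B x = ?B (x - 1) + of_nat n * (x - 1) ^ (n - 1)"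
      "?B (x + \<i>) = ?B (x - 1 + \<i>) + of_nat n * (x - 1 + \<i>) ^ (n - 1)"
      "?B (x - \<i>) = ?B (x - 1 - \<i>) + of_nat n * (x - 1 - \<i>) ^ (n - 1)"
    using shift[of "x - 1"] shift[of "x - 1 + \<i>"] shift[of "x - 1 - \<i>"]
    unfolding cancel .
  \<comment> \<open>On the rows with imaginary offset \<open>\<i>\<close>, 0, \<open>-\<i>\<close>,
    the values of \<open>?B\<close> have weights (1, -2, 1), (-2, 4, -2), (1, -2, 1). These are
    multiples of second differences with unit step, so only the power terms survive.\<close>
  have "8 * ?lhs = of_nat n *
           (2 * (x - 1) ^ (n - 1) - 2 * x ^ (n - 1)
            + (x + \<i>) ^ (n - 1) + (x - \<i>) ^ (n - 1)
            - (x - 1 + \<i>) ^ (n - 1) - (x - 1 - \<i>) ^ (n - 1))"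
    unfolding lhs S eqs shift mult_1_right steps by (simp add: algebra_simps)
  then show ?thesis
    by (simp add: field_simps)
qed

end
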